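(* Let $|s|<1/2$, $0\le k<1$ and $p=2/(2s+1)$. Then $$\mathrm{K}_s(k)=\frac{\pi}{\pi_p}K_p\left(k^{2/p}\right),\qquad \mathrm{E}_s(k)=\frac{\pi}{\pi_p}E_p\left(k^{2/p}\right).$$
   Context: For $|x|<1$, $F(a,b;c;x):=\sum_{n=0}^\infty \frac{(a)_n(b)_n}{(c)_n}\frac{x^n}{n!}$ is the Gaussian hypergeometric series, where $(a)_0:=1$ and $(a)_n:=a(a+1)\cdots(a+n-1)$. For $|s|<1/2$ and $0\le k<1$ the Borweins' generalized complete elliptic integrals are $$\mathrm{K}_s(k):=\frac{\pi}{2}F\left(\frac12-s,\frac12+s;1;k^2\right),\qquad \mathrm{E}_s(k):=\frac{\pi}{2}F\left(-\frac12-s,\frac12+s;1;k^2\right).$$ For $p\in(1,\infty)$, $\pi_p:=2\int_0^1\frac{dt}{(1-t^p)^{1/p}}=\frac{2\pi}{p\sin(\pi/p)}$, and for $k\in[0,1)$ the complete $p$-elliptic integrals are $$K_p(k):=\int_0^1 \frac{dt}{(1-t^p)^{1/p}(1-k^pt^p)^{1-1/p}},\qquad E_p(k):=\int_0^1 \left(\frac{1-k^pt^p}{1-t^p}\right)^{1/p}\,dt.$$ *)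

theory Defs
  imports "HOL-Analysis.Analysis"
begin

definition hypergeo_F :: "real \<Rightarrow> real \<Rightarrow> real \<Rightarrow> real \<Rightarrow> real" where
  "hypergeo_F a b c x =
     (\<Sum>n. pochhammer a n * pochhammer b n / pochhammer c n * (x ^ n / fact n))"

definition borwein_K :: "real \<Rightarrow> real \<Rightarrow> real" where
  "borwein_K s k = pi / 2 * hypergeo_F (1/2 - s) (1/2 + s) 1 (k\<^sup>2)"

definition borwein_E :: "real \<Rightarrow> real \<Rightarrow> real" where
  "borwein_E s k = pi / 2 * hypergeo_F (- (1/2) - s) (1/2 + s) 1 (k\<^sup>2)"

text \<open>
  The integrands below are singular at \<open>t = 1\<close>, where division by zero gives them the
  value 0; a single point does not affect the integral. They are nonnegative, so the
  Henstock-Kurzweil integral over the closed interval is the improper (equivalently the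
  Lebesgue) integral. In the relevant range (\<open>p > 1\<close>, \<open>0 \<le> k < 1\<close>) all bases of
  \<open>powr\<close> are nonnegative, and the convention \<open>0 powr a = 0\<close> agrees with the usual
  power since the exponents are positive.
\<close>

definition pi_p :: "real \<Rightarrow> real" where
  "pi_p p = 2 * integral {0..1} (\<lambda>t. 1 / (1 - t powr p) powr (1 / p))"

definition p_elliptic_K :: "real \<Rightarrow> real \<Rightarrow> real" where
  "p_elliptic_K p k =
     integral {0..1} (\<lambda>t. 1 / ((1 - t powr p) powr (1 / p) *
                               (1 - k powr p * t powr p) powr (1 - 1 / p)))"

definition p_elliptic_E :: "real \<Rightarrow> real \<Rightarrow> real" where
  "p_elliptic_E p k =
     integral {0..1} (\<lambda>t. ((1 - k powr p * t powr p) / (1 - t powr p)) powr (1 / p))"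

end

theory Submission
  imports Defs
begin

text \<open>
  Put \<open>a = 1/p = 1/2 + s\<close> and \<open>w t = (1 - t\<^sup>p)\<^sup>-\<^sup>a\<close>. Expanding the other factor
  \<open>(1 - k\<^sup>2 t\<^sup>p)\<^sup>-\<^sup>b\<close> of the integrand (\<open>b = 1 - a\<close> for K, \<open>b = - a\<close> for E) in its binomial
  series reduces both identities to the moments of \<open>t\<^sup>p\<close> against \<open>w\<close>. These need no Beta
  function: integrating the derivative of \<open>t t\<^sup>p\<^sup>n (1 - t\<^sup>p)\<^sup>1\<^sup>-\<^sup>a\<close>, which vanishes at both
  endpoints, yields a two-term recurrence for them.
\<close>

section \<open>The binomial series in Pochhammer form\<close>

lemma pochhammer_binomial_series:
  fixes b y :: real
  assumes "\<bar>y\<bar> < 1"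
  shows "(\<lambda>n. pochhammer b n / fact n * y ^ n) sums (1 - y) powr (- b)"
proof -
  have "(\<lambda>n. ((- b) gchoose n) * (- y) ^ n) sums (1 + (- y)) powr (- b)"
    using assms by (intro gen_binomial_real) simp
  moreover have "((- b) gchoose n) * (- y) ^ n = pochhammer b n / fact n * y ^ n" for n
    by (simp add: gbinomial_pochhammer power_minus[of y])
  ultimately show ?thesis
    by simp
qed

text \<open>A power series that converges at some \<open>z\<close> with \<open>y < z < 1\<close>
  converges absolutely at \<open>y\<close>. The sum later serves as the constant of a dominating
  function.\<close>

lemma summable_abs_pochhammer_series:
  fixes b y :: real
  assumes "0 \<le> y" "y < 1"
  shows "summable (\<lambda>n. \<bar>pochhammer b n / fact n\<bar> * y ^ n)"
proof -
  obtain z where z: "y < z" "z < 1"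
    using assms dense by blast
  have "summable (\<lambda>n. pochhammer b n / fact n * z ^ n)"
    using pochhammer_binomial_series[of z b] assms z by (auto dest: sums_summable)
  then have "summable (\<lambda>n. norm (pochhammer b n / fact n * y ^ n))"
    by (rule powser_insidea) (use assms z in auto)
  then show ?thesis
    using assms by (simp add: abs_mult)
qed

section \<open>The singular weight and its integrability\<close>

locale elliptic_weight =
  fixes p a :: real
  assumes p_gt_1: "1 < p" and a_eq: "a = 1 / p"
begin

definition weight :: "real \<Rightarrow> real" where
  "weight t = 1 / (1 - t powr p) powr a"

lemma a_pos: "0 < a" and a_less_1: "a < 1"
  using p_gt_1 by (auto simp: a_eq)

lemma weight_nonneg: "0 \<le> weight t"
  by (simp add: weight_def)

lemma powr_p_le_self:
  assumes "0 \<le> t" "t \<le> 1"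
  shows "t powr p \<le> t"
  using assms p_gt_1 powr_mono'[of 1 p t] by simp

lemma powr_p_less_1:
  assumes "0 \<le> t" "t < 1"
  shows "t powr p < 1"
  using powr_p_le_self[of t] assms by simp

text \<open>Since \<open>t powr p\<close> is at most \<open>t\<close>, the weight is dominated by
  \<open>(1 - t) powr (- a)\<close>, which is integrable because \<open>a < 1\<close>.\<close>

lemma weight_integrable: "weight integrable_on {0..1}"
proof (rule measurable_bounded_by_integrable_imp_integrable)
  show "weight \<in> borel_measurable (lebesgue_on {0..1})"
    unfolding weight_def[abs_def] by (intro measurable_restrict_space1 measurable_completion) measurable
  have "((\<lambda>t::real. t powr (- a)) has_integral (1 powr (- a + 1) / (- a + 1))) {0..1}"
    using has_integral_powr_from_0[of "- a" 1] a_less_1 by simp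
  then have "(\<lambda>t::real. t powr (- a)) integrable_on cbox 0 1"
    by (auto simp: integrable_on_def)
  \<comment> \<open>The reflection of \<open>t\<close> to \<open>1 - t\<close> moves the singularity
    from 0 to 1.\<close>
  then have "(\<lambda>t::real. (1 - t) powr (- a)) integrable_on (\<lambda>t. 1 - t) ` cbox 0 1"
    using integrable_affinity[of "\<lambda>t::real. t powr (- a)" 0 1 "- 1" 1] by simp
  then show "(\<lambda>t. (1 - t) powr (- a)) integrable_on {0..1::real}"
    by simp
  fix t :: real
  assume t: "t \<in> {0..1}"
  show "norm (weight t) \<le> (1 - t) powr (- a)"
  proof (cases "t = 1")
    case False
    then have "(1 - t) powr a \<le> (1 - t powr p) powr a" "0 < (1 - t) powr a"
      using t powr_p_le_self[of t] a_pos by (auto intro!: powr_mono2)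
    then show ?thesis
      by (simp add: weight_def powr_minus divide_simps)
  qed (simp add: weight_def)
qed auto

text \<open>Nonnegativity makes the weight absolutely integrable, and this survives multiplication
  by a bounded measurable function.\<close>

lemma integrable_weight_times:
  assumes "continuous_on {0..1} f"
  shows "(\<lambda>t. f t * weight t) integrable_on {0..1}"
proof -
  have "bounded (f ` {0..1})"
    using assms by (intro compact_imp_bounded compact_continuous_image) auto
  moreover have "f \<in> borel_measurable (lebesgue_on {0..1})"
    using assms by (intro continuous_imp_measurable_on_sets_lebesgue) auto
  moreover have "weight absolutely_integrable_on {0..1}"
    using weight_integrable weight_nonneg
    by (intro nonnegative_absolutely_integrable_1) auto
  ultimately have "(\<lambda>t. f t * weight t) absolutely_integrable_on {0..1}"
    by (intro absolutely_integrable_bounded_measurable_product_real) auto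
  then show ?thesis
    by (rule set_lebesgue_integral_eq_integral(1))
qed

section \<open>Moments of \<open>t powr p\<close> against the weight, and termwise
  integration\<close>

definition moment :: "nat \<Rightarrow> real" where
  "moment n = integral {0..1} (\<lambda>t. (t powr p) ^ n * weight t)"

lemma continuous_on_powr_p: "continuous_on {0..1} (\<lambda>t. t powr p)"
  using p_gt_1 by (intro continuous_on_powr' continuous_intros) auto

lemma has_integral_moment:
  "((\<lambda>t. (t powr p) ^ n * weight t) has_integral moment n) {0..1}"
  unfolding moment_def
  by (intro integrable_integral integrable_weight_times continuous_intros continuous_on_powr_p)

lemma moment_Suc: "moment (Suc n) = (a + n) / Suc n * moment n"
proof -
  define G where "G = (\<lambda>t. t * (t powr p) ^ n * (1 - t powr p) powr (1 - a))"
  define g where "g = (\<lambda>t. (p * n + 1) * ((t powr p) ^ n * weight t)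
      - (p * n + p) * ((t powr p) ^ Suc n * weight t))"
  have "(g has_integral G 1 - G 0) {0..1}"
  \<comment> \<open>The interior version is used because the weight is singular at 1, whereas
    \<open>G\<close> stays continuous there thanks to \<open>1 - a > 0\<close>.\<close>
  proof (rule fundamental_theorem_of_calculus_interior)
    show "continuous_on {0..1} G"
      unfolding G_def
      using a_less_1 p_gt_1
      by (intro continuous_on_mult continuous_on_id continuous_on_power continuous_on_powr'
          continuous_on_diff continuous_on_const continuous_on_powr_p) (auto intro: powr_le1)
    fix t :: real
    assume t: "t \<in> {0<..<1}"
    define u where "u = t powr p"
    have u: "0 < u" "u < 1"
      using t powr_p_less_1[of t] by (auto simp: u_def)
    have t_powr: "t powr (p - 1) = u / t"
      using t by (simp add: u_def powr_diff)
    have du: "((\<lambda>t. t powr p) has_real_derivative p * u / t) (at t)"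
      using t by (auto intro!: derivative_eq_intros simp: t_powr)
    have dpow: "((\<lambda>t. (t powr p) ^ n) has_real_derivative n * p * u ^ n / t) (at t)"
      using DERIV_power[OF du, of n] t u by (cases n) (auto simp: u_def field_simps)
    have dw: "((\<lambda>t. (1 - t powr p) powr (1 - a)) has_real_derivative
        - ((1 - a) * p * u / t * weight t)) (at t)"
      using u t
      by (auto intro!: derivative_eq_intros
          simp: t_powr u_def[symmetric] weight_def powr_minus field_simps)
    \<comment> \<open>This turns both terms of the product rule into multiples of
      \<open>weight t\<close>, so that the derivative becomes a combination of two consecutive
      moment integrands.\<close>
    have split: "(1 - u) powr (1 - a) = (1 - u) * weight t"
      using u by (simp add: weight_def u_def[symmetric] powr_diff)
    have "(G has_real_derivative
        (1 * u ^ n + n * p * u ^ n / t * t) * (1 - u) powr (1 - a)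
          + - ((1 - a) * p * u / t * weight t) * (t * u ^ n)) (at t)"
      unfolding G_def u_def
      by (intro DERIV_mult DERIV_ident dpow[unfolded u_def] dw[unfolded u_def])
    moreover have "(1 * u ^ n + n * p * u ^ n / t * t) * (1 - u) powr (1 - a)
          + - ((1 - a) * p * u / t * weight t) * (t * u ^ n) = g t"
    proof -
      have "(1 - a) * p = p - 1"
        using p_gt_1 by (simp add: a_eq field_simps)
      then show ?thesis
        using t by (simp add: split g_def u_def[symmetric]) (simp add: algebra_simps)
    qed
    ultimately show "(G has_vector_derivative g t) (at t)"
      by (simp add: has_real_derivative_iff_has_vector_derivative)
  qed simp
  moreover have "(g has_integral (p * n + 1) * moment n - (p * n + p) * moment (Suc n)) {0..1}"
    unfolding g_def by (intro has_integral_diff has_integral_mult_right has_integral_moment)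
  ultimately have "(p * n + 1) * moment n - (p * n + p) * moment (Suc n) = G 1 - G 0"
    by (metis has_integral_unique)
  \<comment> \<open>The boundary terms vanish: at 0 through the factor \<open>t\<close>, at 1
    through \<open>0 powr (1 - a) = 0\<close>.\<close>
  then have "(p * n + 1) * moment n = (p * n + p) * moment (Suc n)"
    by (simp add: G_def)
  moreover have "p * n + 1 = p * (a + n)" "p * n + p = p * Suc n"
    using p_gt_1 by (auto simp: a_eq field_simps)
  ultimately have "p * ((a + n) * moment n) = p * (Suc n * moment (Suc n))"
    by (simp only: mult.assoc)
  then have "(a + n) * moment n = Suc n * moment (Suc n)"
    using p_gt_1 by (simp only: mult_cancel_left) simp
  then show ?thesis
    by (simp add: divide_simps del: of_nat_Suc)
qed

lemma moment_eq: "moment n = pochhammer a n / fact n * moment 0"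
proof (induction n)
  case (Suc n)
  then show ?case
    by (simp only: moment_Suc pochhammer_Suc fact_Suc of_nat_mult) (simp add: mult_ac)
qed simp

text \<open>The minorant \<open>1 - t\<close>, with integral 1/2, is chosen instead of the constant
  1 because \<open>weight 1 = 0\<close> by the convention on division by zero.\<close>

lemma moment_0_pos: "0 < moment 0"
proof -
  have "((\<lambda>t::real. 1 - t) has_integral (1 - 1\<^sup>2 / 2) - (0 - 0\<^sup>2 / 2)) {0..1}"
    by (rule fundamental_theorem_of_calculus)
      (auto intro!: derivative_eq_intros simp flip: has_real_derivative_iff_has_vector_derivative)
  moreover have "1 - t \<le> (t powr p) ^ 0 * weight t" if t: "t \<in> {0..1}" for t
  proof (cases "t = 1")
    case False
    then have "0 < 1 - t powr p" "1 - t powr p \<le> 1"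
      using t powr_p_less_1[of t] by auto
    then have "(1 - t powr p) powr a \<le> 1" "0 < (1 - t powr p) powr a"
      using a_pos by (auto intro: powr_le1)
    then have "1 \<le> weight t"
      by (simp add: weight_def)
    then show ?thesis
      using t by simp
  qed (simp add: weight_def)
  ultimately have "(1 - 1\<^sup>2 / 2) - (0 - 0\<^sup>2 / 2) \<le> moment 0"
    using has_integral_le has_integral_moment by blast
  then show ?thesis
    by simp
qed

text \<open>The binomial series in \<open>x * t powr p\<close> is integrated term by term; each
  moment contributes the factor \<open>pochhammer a n / fact n\<close>. Keeping \<open>b\<close>
  free covers both elliptic integrals.\<close>

lemma integral_binomial_weight:
  assumes "0 \<le> x" "x < 1"
  shows "integral {0..1} (\<lambda>t. (1 - x * t powr p) powr (- b) * weight t)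
    = moment 0 * hypergeo_F b a 1 x"
proof -
  define c where "c n = pochhammer b n / fact n" for n
  define S where "S N t = (\<Sum>n<N. c n * x ^ n * ((t powr p) ^ n * weight t))" for N t
  define C where "C = (\<Sum>n. \<bar>c n\<bar> * x ^ n)"
  have summ: "summable (\<lambda>n. \<bar>c n\<bar> * x ^ n)"
    unfolding c_def using assms by (rule summable_abs_pochhammer_series)
  have int_S: "(S N has_integral (\<Sum>n<N. c n * x ^ n * moment n)) {0..1}" for N
    unfolding S_def by (intro has_integral_sum has_integral_mult_right has_integral_moment) auto
  have "(\<lambda>N. integral {0..1} (S N)) \<longlonglongrightarrow>
      integral {0..1} (\<lambda>t. (1 - x * t powr p) powr (- b) * weight t)"
  \<comment> \<open>As \<open>t powr p\<close> lies in [0,1], every partial sum is bounded by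
    \<open>C * weight t\<close>, where \<open>C\<close> is the absolute sum at
    \<open>x\<close>.\<close>
  proof (rule dominated_convergence(2))
    show "S N integrable_on {0..1}" for N
      using int_S by blast
    show "(\<lambda>t. C * weight t) integrable_on {0..1}"
      using weight_integrable by (rule integrable_on_mult_right)
    show "norm (S N t) \<le> C * weight t" if t: "t \<in> {0..1}" for N t
    proof -
      have u: "0 \<le> t powr p" "t powr p \<le> 1"
        using t powr_p_le_self[of t] by auto
      have "norm (S N t) \<le> (\<Sum>n<N. \<bar>c n\<bar> * x ^ n * weight t)"
        unfolding S_def
      proof (rule sum_norm_le)
        fix n
        have "\<bar>c n\<bar> * x ^ n * ((t powr p) ^ n * weight t) \<le> \<bar>c n\<bar> * x ^ n * (1 * weight t)"
          using u assms weight_nonneg by (intro mult_left_mono mult_right_mono power_le_one) auto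
        then show "norm (c n * x ^ n * ((t powr p) ^ n * weight t)) \<le> \<bar>c n\<bar> * x ^ n * weight t"
          using assms weight_nonneg by (simp add: abs_mult)
      qed
      also have "\<dots> = (\<Sum>n<N. \<bar>c n\<bar> * x ^ n) * weight t"
        by (simp add: sum_distrib_right)
      also have "\<dots> \<le> C * weight t"
        unfolding C_def using summ assms weight_nonneg
        by (intro mult_right_mono sum_le_suminf) auto
      finally show ?thesis .
    qed
    show "(\<lambda>N. S N t) \<longlonglongrightarrow> (1 - x * t powr p) powr (- b) * weight t" if t: "t \<in> {0..1}" for t
    proof -
      have "x * t powr p \<le> x * 1"
        using t powr_p_le_self[of t] assms by (intro mult_left_mono) auto
      then have "\<bar>x * t powr p\<bar> < 1"
        using assms by simp
      then have "(\<lambda>n. c n * (x * t powr p) ^ n * weight t) sums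
          ((1 - x * t powr p) powr (- b) * weight t)"
        unfolding c_def by (intro sums_mult2 pochhammer_binomial_series)
      then show ?thesis
        by (simp add: sums_def S_def power_mult_distrib mult.assoc)
    qed
  qed
  moreover have "integral {0..1} (S N) = (\<Sum>n<N. c n * x ^ n * moment n)" for N
    using int_S by (rule integral_unique)
  ultimately have sums: "(\<lambda>n. c n * x ^ n * moment n) sums
      integral {0..1} (\<lambda>t. (1 - x * t powr p) powr (- b) * weight t)"
    by (simp add: sums_def)
  define h where "h n = pochhammer b n * pochhammer a n / pochhammer 1 n * (x ^ n / fact n)" for n
  have "c n * x ^ n * moment n = moment 0 * h n" for n
    by (subst moment_eq) (simp add: c_def h_def pochhammer_fact[symmetric])
  with sums have *: "(\<lambda>n. moment 0 * h n) sums
      integral {0..1} (\<lambda>t. (1 - x * t powr p) powr (- b) * weight t)"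
    by simp
  \<comment> \<open>Cancelling the nonzero factor \<open>moment 0\<close> gives the summability
    needed to pull that factor out of the infinite sum.\<close>
  then have "summable h"
    using moment_0_pos by (auto dest!: sums_summable simp: summable_cmult_iff)
  then have "(\<Sum>n. moment 0 * h n) = moment 0 * (\<Sum>n. h n)"
    by (rule suminf_mult)
  with * show ?thesis
    by (simp add: sums_iff hypergeo_F_def h_def)
qed

section \<open>The p-elliptic integrals as hypergeometric series\<close>

lemma pi_p_eq: "pi_p p = 2 * moment 0"
  by (simp add: pi_p_def moment_def weight_def flip: a_eq)

lemma p_elliptic_K_eq:
  assumes "k powr p < 1"
  shows "p_elliptic_K p k = pi_p p / 2 * hypergeo_F (1 - a) a 1 (k powr p)"
proof -
  have "p_elliptic_K p k
      = integral {0..1} (\<lambda>t. (1 - k powr p * t powr p) powr (- (1 - a)) * weight t)"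
    unfolding p_elliptic_K_def weight_def powr_minus_divide a_eq[symmetric]
    by (simp add: mult.commute)
  then show ?thesis
    using integral_binomial_weight[of "k powr p" "1 - a"] assms by (simp add: pi_p_eq)
qed

lemma p_elliptic_E_eq:
  assumes "k powr p < 1"
  shows "p_elliptic_E p k = pi_p p / 2 * hypergeo_F (- a) a 1 (k powr p)"
proof -
  \<comment> \<open>The power of the quotient splits because numerator and denominator are
    nonnegative. At \<open>t = 1\<close> both sides are 0.\<close>
  have "((1 - k powr p * t powr p) / (1 - t powr p)) powr (1 / p)
      = (1 - k powr p * t powr p) powr (- (- a)) * weight t" if "t \<in> {0..1}" for t
  proof -
    have "t powr p \<le> 1"
      using that powr_p_le_self[of t] by simp
    moreover have "k powr p * t powr p \<le> 1"
      using calculation assms by (intro mult_le_one) auto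
    ultimately show ?thesis
      by (simp add: weight_def powr_divide flip: a_eq)
  qed
  then have "p_elliptic_E p k
      = integral {0..1} (\<lambda>t. (1 - k powr p * t powr p) powr (- (- a)) * weight t)"
    unfolding p_elliptic_E_def by (intro integral_cong)
  then show ?thesis
    using integral_binomial_weight[of "k powr p" "- a"] assms by (simp add: pi_p_eq)
qed

end

theorem mainTheorem5:
  fixes s k p :: real
  assumes "\<bar>s\<bar> < 1 / 2"
    and "0 \<le> k" and "k < 1"
    and "p = 2 / (2 * s + 1)"
  shows "borwein_K s k = pi / pi_p p * p_elliptic_K p (k powr (2 / p)) \<and>
         borwein_E s k = pi / pi_p p * p_elliptic_E p (k powr (2 / p))"
proof -
  have s: "0 < 2 * s + 1" "2 * s + 1 < 2"
    using assms(1) by (auto simp: abs_less_iff)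
  \<comment> \<open>The choice of \<open>p\<close> means \<open>1 / p = 1/2 + s\<close>, and
    \<open>s < 1/2\<close> gives \<open>p > 1\<close>.\<close>
  interpret elliptic_weight p "1/2 + s"
    using s by unfold_locales (auto simp: assms(4) field_simps)
  have "(k powr (2 / p)) powr p = k powr 2"
    using p_gt_1 by (simp add: powr_powr)
  then have k2: "(k powr (2 / p)) powr p = k\<^sup>2"
    using assms(2) by simp
  have "k\<^sup>2 < 1"
    using assms(2,3) by (simp add: power_less_one_iff)
  \<comment> \<open>Needed to cancel \<open>pi_p p\<close> against the prefactor
    \<open>pi / pi_p p\<close>, leaving \<open>pi / 2\<close>.\<close>
  moreover have "pi_p p \<noteq> 0"
    using moment_0_pos by (simp add: pi_p_eq)
  moreover have "1 - (1/2 + s) = 1/2 - s" "- (1/2 + s) = - (1/2) - s"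
    by simp_all
  ultimately have KE:
    "p_elliptic_K p (k powr (2 / p)) = pi_p p / 2 * hypergeo_F (1/2 - s) (1/2 + s) 1 (k\<^sup>2)"
    "p_elliptic_E p (k powr (2 / p)) = pi_p p / 2 * hypergeo_F (- (1/2) - s) (1/2 + s) 1 (k\<^sup>2)"
    using p_elliptic_K_eq[of "k powr (2 / p)"] p_elliptic_E_eq[of "k powr (2 / p)"]
    by (simp_all only: k2)
  show ?thesis
    unfolding KE borwein_K_def borwein_E_def using \<open>pi_p p \<noteq> 0\<close> by simp
qed

end
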